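(* Let $n\ge2$, let $d_i$ be a metric on a nontrivial real vector space $X_i$ $(i=1,\ldots,n)$, let $\psi,\phi\in\Psi_n$, and let $\sigma\in[1,\infty)$. Then $$\left(\frac{\mathrm{m}_n}{\mathrm{M}_n}\right)^\sigma\cdot C_{\mathrm{NJ}}^{(\sigma)}(d_\phi)\le C_{\mathrm{NJ}}^{(\sigma)}(d_\psi)\le\left(\frac{\mathrm{M}_n}{\mathrm{m}_n}\right)^\sigma\cdot C_{\mathrm{NJ}}^{(\sigma)}(d_\phi),$$ where $$\mathrm{m}_n:=\min_{t\in\Omega_n}\frac{\psi(t)}{\phi(t)}\quad\text{and}\quad\mathrm{M}_n:=\max_{t\in\Omega_n}\frac{\psi(t)}{\phi(t)}.$$
   Context: $\Omega_n:=\{(t_1,\ldots,t_n)\in\mathbb{R}^n: t_i\ge0,\ \sum_{i=1}^nt_i=1\}$, and $\mathbf{e}_1,\ldots,\mathbf{e}_n$ is the standard basis of $\mathbb{R}^n$. $\Psi_n$ is the class of all continuous convex functions $\psi:\Omega_n\to[0,\infty)$ such that $\psi(\mathbf{e}_1)=\cdots=\psi(\mathbf{e}_n)=1$ and, for each $i=1,\ldots,n$ and all $(t_1,\ldots,t_n)\in\Omega_n$ with $t_i<1$, $$\psi(t_1,\ldots,t_n)\ge(1-t_i)\,\psi\left(\tfrac{t_1}{1-t_i},\ldots,\tfrac{t_{i-1}}{1-t_i},0,\tfrac{t_{i+1}}{1-t_i},\ldots,\tfrac{t_n}{1-t_i}\right).$$ Every function in $\Psi_n$ is strictly positive on $\Omega_n$,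 so the quotients are well defined. Let $\mathrm{P}:=X_1\times\cdots\times X_n$. For $\psi\in\Psi_n$, $d_\psi$ is the metric on $\mathrm{P}$ defined for $x=(x_1,\ldots,x_n)$, $y=(y_1,\ldots,y_n)$ by $d_\psi(x,x):=0$ and, if $x\ne y$, with $S:=\sum_{i=1}^nd_i(x_i,y_i)$, by $d_\psi(x,y):=S\cdot\psi\left(\frac{d_1(x_1,y_1)}{S},\ldots,\frac{d_n(x_n,y_n)}{S}\right)$. For a metric $d$ on a real vector space $X$ with $f(x):=d(x,0_X)$ and $f^\sigma(x):=(f(x))^\sigma$, the von Neumann-Jordan constant of order $\sigma$ is $$C_{\mathrm{NJ}}^{(\sigma)}(d):=\sup_{(x,y)\ne(0_X,0_X)}\frac{f^\sigma(x+y)+f^\sigma(x-y)}{2^{\sigma-1}(f^\sigma(x)+f^\sigma(y))}\in(0,\infty].$$ No translation-invariance or continuity of the vector space operations is assumed. *)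

theory Defs
  imports "HOL-Analysis.Analysis"
begin

definition Omega :: "(real ^ 'n) set" where
  "Omega = {t. (\<forall>i. 0 \<le> t $ i) \<and> (\<Sum>i\<in>UNIV. t $ i) = 1}"

(* Only the values on Omega matter: membership in Psi says nothing about psi elsewhere. *)
definition Psi :: "(real ^ 'n \<Rightarrow> real) set" where
  "Psi = {\<psi>. continuous_on Omega \<psi> \<and> convex_on Omega \<psi> \<and>
            (\<forall>t\<in>Omega. 0 \<le> \<psi> t) \<and>
            (\<forall>i. \<psi> (axis i 1) = 1) \<and>
            (\<forall>i. \<forall>t\<in>Omega. t $ i < 1 \<longrightarrow>
               \<psi> t \<ge> (1 - t $ i) * \<psi> (\<chi> j. if j = i then 0 else t $ j / (1 - t $ i)))}"

(* The spaces X i are subspaces of a common real vector space.  This loses no generality: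
   any finite family of real vector spaces embeds into its direct product. *)
definition prod_space :: "('n \<Rightarrow> 'a set) \<Rightarrow> ('a ^ 'n) set" where
  "prod_space X = {x. \<forall>i. x $ i \<in> X i}"

definition psi_metric ::
    "('n \<Rightarrow> 'a \<Rightarrow> 'a \<Rightarrow> real) \<Rightarrow> (real ^ 'n \<Rightarrow> real) \<Rightarrow> 'a ^ 'n \<Rightarrow> 'a ^ 'n \<Rightarrow> real" where
  "psi_metric d \<psi> x y =
     (if x = y then 0
      else (let S = (\<Sum>i\<in>UNIV. d i (x $ i) (y $ i))
            in S * \<psi> (\<chi> i. d i (x $ i) (y $ i) / S)))"

(* The constant of a metric d on the vector space V, a subspace of 'v.  The value may be
   infinite.  The exponent is real; 0 powr \<sigma> = 0, as it should be for \<sigma> > 0. *)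
definition CNJ :: "'v::real_vector set \<Rightarrow> real \<Rightarrow> ('v \<Rightarrow> 'v \<Rightarrow> real) \<Rightarrow> ereal" where
  "CNJ V \<sigma> d =
     (SUP (x, y) \<in> V \<times> V - {(0, 0)}.
        ereal ((d (x + y) 0 powr \<sigma> + d (x - y) 0 powr \<sigma>) /
               (2 powr (\<sigma> - 1) * (d x 0 powr \<sigma> + d y 0 powr \<sigma>))))"

(* LEAST and GREATEST of the set of values: the minimum and maximum themselves,
   which exist because Omega is compact. *)
definition min_ratio :: "(real ^ 'n \<Rightarrow> real) \<Rightarrow> (real ^ 'n \<Rightarrow> real) \<Rightarrow> real" where
  "min_ratio \<psi> \<phi> = (LEAST r. r \<in> (\<lambda>t. \<psi> t / \<phi> t) ` Omega)"

definition max_ratio :: "(real ^ 'n \<Rightarrow> real) \<Rightarrow> (real ^ 'n \<Rightarrow> real) \<Rightarrow> real" where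
  "max_ratio \<psi> \<phi> = (GREATEST r. r \<in> (\<lambda>t. \<psi> t / \<phi> t) ` Omega)"

end

theory Submission
  imports Defs
begin

text \<open>Removing the coordinates of \<open>t\<close> other than \<open>t\<^sub>k\<close> one at a time shows
  \<open>\<psi> t \<ge> t\<^sub>k\<close>, so \<open>\<psi>\<close> and \<open>\<phi>\<close> are positive and \<open>0 < m \<le> \<psi> / \<phi> \<le> M\<close> on the compact simplex.
  Hence \<open>m d\<^sub>\<phi> \<le> d\<^sub>\<psi> \<le> M d\<^sub>\<phi>\<close>, and this is symmetric in the two metrics up to replacing
  \<open>(m, M)\<close> by \<open>(1/M, 1/m)\<close>; so one comparison of the defining quotients gives both bounds.\<close>

lemma compact_Omega: "compact (Omega :: (real ^ 'n) set)"
proof -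
  have "closed {t :: real ^ 'n. (\<forall>i. 0 \<le> t $ i) \<and> (\<Sum>i\<in>UNIV. t $ i) = 1}"
    by (intro closed_Collect_conj closed_Collect_all closed_Collect_le closed_Collect_eq
        continuous_intros)
  moreover have "norm t \<le> 1" if "t \<in> Omega" for t :: "real ^ 'n"
    using norm_le_l1_cart[of t] that by (simp add: Omega_def)
  ultimately show ?thesis
    unfolding compact_eq_bounded_closed bounded_iff by (auto simp: Omega_def)
qed

lemma axis_in_Omega: "axis k 1 \<in> Omega"
  by (simp add: Omega_def axis_def)

text \<open>Induction on the size of the support of \<open>t\<close>. If some \<open>i\<close> other
  than \<open>k\<close> lies in the support, the defining inequality of \<open>Psi\<close> passes to
  the point \<open>u\<close> with coordinate \<open>i\<close> deleted and the rest rescaled; since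
  \<open>u $ k\<close> is \<open>t $ k / (1 - t $ i)\<close>, the factor \<open>1 - t $ i\<close>
  cancels. Otherwise \<open>t\<close> is the vertex at \<open>k\<close>, where \<open>\<psi>\<close>
  is 1.\<close>

lemma Psi_ge_component:
  assumes \<psi>: "\<psi> \<in> Psi" and "t \<in> Omega"
  shows "t $ k \<le> \<psi> t"
  using \<open>t \<in> Omega\<close>
proof (induction "card {i. t $ i \<noteq> 0}" arbitrary: t rule: less_induct)
  case less
  have nn: "0 \<le> t $ i" for i
    using less.prems by (simp add: Omega_def)
  have sum1: "(\<Sum>i\<in>UNIV. t $ i) = 1"
    using less.prems by (simp add: Omega_def)
  show ?case
  proof (cases "t $ k = 0")
    case True
    then show ?thesis using \<psi> less.prems by (simp add: Psi_def)
  next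
    case False
    show ?thesis
    proof (cases "\<exists>i. i \<noteq> k \<and> t $ i \<noteq> 0")
      case True
      then obtain i where i: "i \<noteq> k" "t $ i \<noteq> 0" by blast
      define u where "u = (\<chi> j. if j = i then 0 else t $ j / (1 - t $ i))"
      have rest: "(\<Sum>j\<in>UNIV - {i}. t $ j) = 1 - t $ i"
        using sum1 by (simp add: sum_diff1)
      \<comment> \<open>The positive coordinate at \<open>k\<close> leaves \<open>t $ i\<close>
        strictly below 1, so the rescaling makes sense.\<close>
      have "t $ k \<le> (\<Sum>j\<in>UNIV - {i}. t $ j)"
        using i nn by (intro member_le_sum) auto
      with rest False nn[of k] have lt: "t $ i < 1" by linarith
      have "(\<Sum>j\<in>UNIV. u $ j) = (\<Sum>j\<in>UNIV - {i}. t $ j / (1 - t $ i))"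
        unfolding u_def by (intro sum.mono_neutral_cong_right) auto
      also have "\<dots> = 1"
        using rest lt by (simp flip: sum_divide_distrib)
      finally have "u \<in> Omega"
        using nn lt by (auto simp: Omega_def u_def)
      moreover have "card {j. u $ j \<noteq> 0} < card {j. t $ j \<noteq> 0}"
        using i by (intro psubset_card_mono) (auto simp: u_def)
      ultimately have "u $ k \<le> \<psi> u"
        by (intro less.hyps)
      then have "(1 - t $ i) * (u $ k) \<le> (1 - t $ i) * \<psi> u"
        using lt by (intro mult_left_mono) auto
      also have "\<dots> \<le> \<psi> t"
        using \<psi> less.prems lt by (simp add: Psi_def u_def)
      finally show ?thesis
        using lt i by (simp add: u_def)
    next
      case False
      then have "(\<Sum>i\<in>UNIV. t $ i) = (\<Sum>i\<in>{k}. t $ i)"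
        by (intro sum.mono_neutral_right) auto
      with sum1 have "t $ k = 1" by simp
      with False have "t = axis k 1"
        by (auto simp: vec_eq_iff axis_def)
      then show ?thesis
        using \<psi> by (simp add: Psi_def axis_def)
    qed
  qed
qed

lemma Psi_pos:
  assumes "\<psi> \<in> Psi" and "t \<in> Omega"
  shows "0 < \<psi> t"
proof -
  obtain k where "t $ k \<noteq> 0"
    using \<open>t \<in> Omega\<close> by (force simp: Omega_def)
  then have "0 < t $ k"
    using \<open>t \<in> Omega\<close> by (simp add: Omega_def less_le)
  also have "\<dots> \<le> \<psi> t"
    using assms by (rule Psi_ge_component)
  finally show ?thesis .
qed

text \<open>\<open>LEAST\<close> and \<open>GREATEST\<close> say something only when the extrema are
  attained. Positivity of \<open>\<phi>\<close> makes the quotient continuous, and compactness of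
  \<open>Omega\<close> then supplies the extremal points.\<close>

lemma
  fixes \<psi> \<phi> :: "real ^ 'n \<Rightarrow> real"
  assumes \<psi>: "\<psi> \<in> Psi" and \<phi>: "\<phi> \<in> Psi"
  shows min_ratio_pos: "0 < min_ratio \<psi> \<phi>"
    and min_ratio_le: "\<And>t. t \<in> Omega \<Longrightarrow> min_ratio \<psi> \<phi> \<le> \<psi> t / \<phi> t"
    and le_max_ratio: "\<And>t. t \<in> Omega \<Longrightarrow> \<psi> t / \<phi> t \<le> max_ratio \<psi> \<phi>"
    and max_ratio_pos: "0 < max_ratio \<psi> \<phi>"
proof -
  let ?q = "\<lambda>t. \<psi> t / \<phi> t"
  have pos: "0 < ?q t" if "t \<in> Omega" for t
    using Psi_pos[OF \<psi> that] Psi_pos[OF \<phi> that] by simp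
  have ne: "(Omega :: (real ^ 'n) set) \<noteq> {}"
    using axis_in_Omega by blast
  have cont: "continuous_on Omega ?q"
  proof (rule continuous_on_divide)
    show "continuous_on Omega \<psi>" "continuous_on Omega \<phi>"
      using \<psi> \<phi> by (simp_all add: Psi_def)
    show "\<forall>t\<in>Omega. \<phi> t \<noteq> 0"
      using Psi_pos[OF \<phi>] by fastforce
  qed
  obtain a where a: "a \<in> Omega" "\<And>t. t \<in> Omega \<Longrightarrow> ?q a \<le> ?q t"
    using continuous_attains_inf[OF compact_Omega ne cont] by blast
  obtain b where b: "b \<in> Omega" "\<And>t. t \<in> Omega \<Longrightarrow> ?q t \<le> ?q b"
    using continuous_attains_sup[OF compact_Omega ne cont] by blast
  have min: "min_ratio \<psi> \<phi> = ?q a"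
    unfolding min_ratio_def by (rule Least_equality) (use a in auto)
  have max: "max_ratio \<psi> \<phi> = ?q b"
    unfolding max_ratio_def by (rule Greatest_equality) (use b in auto)
  show "0 < min_ratio \<psi> \<phi>" "0 < max_ratio \<psi> \<phi>"
    using pos a(1) b(1) by (simp_all only: min max)
  show "min_ratio \<psi> \<phi> \<le> ?q t" "?q t \<le> max_ratio \<psi> \<phi>" if "t \<in> Omega" for t
    using a(2)[OF that] b(2)[OF that] by (simp_all only: min max)
qed

text \<open>The first case includes \<open>S = 0\<close> with \<open>x \<noteq> y\<close>: then \<open>\<psi>\<close> is evaluated at the point \<open>0\<close> outside
  \<open>Omega\<close>, but the value is multiplied by \<open>S\<close>.\<close>
lemma psi_metric_cases:
  assumes "\<And>i a b. 0 \<le> d i a b"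
  obtains "\<And>\<psi>. psi_metric d \<psi> x y = 0"
  | S t where "0 < S" "t \<in> Omega" "\<And>\<psi>. psi_metric d \<psi> x y = S * \<psi> t"
proof -
  define S where "S = (\<Sum>i\<in>UNIV. d i (x $ i) (y $ i))"
  define t where "t = (\<chi> i. d i (x $ i) (y $ i) / S)"
  have eq: "psi_metric d \<psi> x y = (if x = y then 0 else S * \<psi> t)" for \<psi>
    by (simp add: psi_metric_def S_def t_def Let_def)
  have "0 \<le> S"
    unfolding S_def using assms by (intro sum_nonneg) auto
  show thesis
  proof (cases "x = y \<or> S = 0")
    case True
    then show thesis using that(1) eq by auto
  next
    case False
    with \<open>0 \<le> S\<close> have "0 < S" by simp
    then have "t \<in> Omega"
      using assms by (auto simp: Omega_def t_def S_def simp flip: sum_divide_distrib)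
    with \<open>0 < S\<close> False show thesis using that(2) eq by auto
  qed
qed

text \<open>Both metrics use the same factor \<open>S\<close> and the same point \<open>t\<close> of
  \<open>Omega\<close>, so the bounds on the ratio at \<open>t\<close> carry over after
  multiplication by \<open>S\<close>.\<close>

lemma
  assumes d: "\<And>i a b. 0 \<le> d i a b" and \<psi>: "\<psi> \<in> Psi" and \<phi>: "\<phi> \<in> Psi"
  shows psi_metric_nonneg: "0 \<le> psi_metric d \<phi> x y"
    and min_ratio_psi_metric: "min_ratio \<psi> \<phi> * psi_metric d \<phi> x y \<le> psi_metric d \<psi> x y"
    and max_ratio_psi_metric: "psi_metric d \<psi> x y \<le> max_ratio \<psi> \<phi> * psi_metric d \<phi> x y"
proof -
  have "0 \<le> psi_metric d \<phi> x y \<and>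
        min_ratio \<psi> \<phi> * psi_metric d \<phi> x y \<le> psi_metric d \<psi> x y \<and>
        psi_metric d \<psi> x y \<le> max_ratio \<psi> \<phi> * psi_metric d \<phi> x y"
  proof (cases rule: psi_metric_cases[where d = d and x = x and y = y, OF d])
    case 1
    then show ?thesis by simp
  next
    case (2 S t)
    have "0 < \<phi> t" using \<phi> 2(2) by (rule Psi_pos)
    then have "min_ratio \<psi> \<phi> * \<phi> t \<le> \<psi> t" "\<psi> t \<le> max_ratio \<psi> \<phi> * \<phi> t"
      using min_ratio_le[OF \<psi> \<phi> 2(2)] le_max_ratio[OF \<psi> \<phi> 2(2)] by (simp_all add: field_simps)
    then have "S * (min_ratio \<psi> \<phi> * \<phi> t) \<le> S * \<psi> t" "S * \<psi> t \<le> S * (max_ratio \<psi> \<phi> * \<phi> t)"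
      using 2(1) by (simp_all add: mult_left_mono)
    then show ?thesis
      using 2 \<open>0 < \<phi> t\<close> by (simp add: 2(3) mult_ac)
  qed
  then show "0 \<le> psi_metric d \<phi> x y"
    and "min_ratio \<psi> \<phi> * psi_metric d \<phi> x y \<le> psi_metric d \<psi> x y"
    and "psi_metric d \<psi> x y \<le> max_ratio \<psi> \<phi> * psi_metric d \<phi> x y"
    by auto
qed

text \<open>Passing from \<open>g\<close> to \<open>f\<close> enlarges the numerator by at most
  \<open>M powr \<sigma>\<close> and shrinks the denominator by at most
  \<open>m powr \<sigma>\<close>. Arbitrary \<open>f\<close> and \<open>g\<close> allow a second use
  with the roles exchanged.\<close>

lemma CNJ_le_of_equivalent:
  fixes f g :: "'v::real_vector \<Rightarrow> 'v \<Rightarrow> real"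
  assumes m: "0 < m" and M: "0 < M" and \<sigma>: "0 \<le> \<sigma>"
    and g: "\<And>x. 0 \<le> g x 0"
    and lower: "\<And>x. m * g x 0 \<le> f x 0" and upper: "\<And>x. f x 0 \<le> M * g x 0"
  shows "CNJ V \<sigma> f \<le> ereal ((M / m) powr \<sigma>) * CNJ V \<sigma> g"
proof -
  have f: "0 \<le> f x 0" for x
    using lower[of x] g[of x] m by (meson mult_nonneg_nonneg order_trans less_imp_le)
  have lo: "m powr \<sigma> * g x 0 powr \<sigma> \<le> f x 0 powr \<sigma>" for x
    using powr_mono2[OF \<sigma> _ lower[of x]] m g[of x] by (simp add: powr_mult)
  have up: "f x 0 powr \<sigma> \<le> M powr \<sigma> * g x 0 powr \<sigma>" for x
    using powr_mono2[OF \<sigma> f upper[of x]] M g[of x] by (simp add: powr_mult)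
  define N where "N = (\<lambda>(h :: 'v \<Rightarrow> 'v \<Rightarrow> real) x y. h (x + y) 0 powr \<sigma> + h (x - y) 0 powr \<sigma>)"
  define D where "D = (\<lambda>(h :: 'v \<Rightarrow> 'v \<Rightarrow> real) x y. 2 powr (\<sigma> - 1) * (h x 0 powr \<sigma> + h y 0 powr \<sigma>))"
  have quot: "N f x y / D f x y \<le> (M / m) powr \<sigma> * (N g x y / D g x y)" for x y
  proof -
    have nonneg: "0 \<le> N f x y" "0 \<le> D g x y" "0 \<le> D f x y" by (simp_all add: N_def D_def)
    have num: "N f x y \<le> M powr \<sigma> * N g x y"
      using up[of "x + y"] up[of "x - y"] by (simp add: N_def algebra_simps)
    have "2 powr (\<sigma> - 1) * (m powr \<sigma> * (g x 0 powr \<sigma> + g y 0 powr \<sigma>)) \<le> D f x y"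
      unfolding D_def using lo[of x] lo[of y] by (intro mult_left_mono) (simp_all add: distrib_left)
    then have den: "m powr \<sigma> * D g x y \<le> D f x y"
      by (simp add: D_def mult_ac)
    show ?thesis
    proof (cases "D g x y = 0")
      \<comment> \<open>Here the quotient for \<open>g\<close> is 0 by the convention for division
        by zero. The upper bound forces the denominator for \<open>f\<close> to vanish as well, so
        both sides are 0.\<close>
      case True
      have "2 powr (\<sigma> - 1) * (f x 0 powr \<sigma> + f y 0 powr \<sigma>)
              \<le> 2 powr (\<sigma> - 1) * (M powr \<sigma> * (g x 0 powr \<sigma> + g y 0 powr \<sigma>))"
        using up[of x] up[of y] by (intro mult_left_mono) (simp_all add: distrib_left)
      then have "D f x y \<le> M powr \<sigma> * D g x y" by (simp add: D_def mult_ac)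
      with True nonneg have "D f x y = 0" by simp
      with True show ?thesis by simp
    next
      case False
      with nonneg m have "0 < m powr \<sigma> * D g x y" by simp
      with num den nonneg have "N f x y / D f x y \<le> (M powr \<sigma> * N g x y) / (m powr \<sigma> * D g x y)"
        by (intro frac_le) auto
      also have "\<dots> = (M / m) powr \<sigma> * (N g x y / D g x y)"
        using m M by (simp add: powr_divide)
      finally show ?thesis .
    qed
  qed
  have CNJ: "CNJ V \<sigma> h = (SUP (x, y) \<in> V \<times> V - {(0, 0)}. ereal (N h x y / D h x y))" for h
    by (simp add: CNJ_def N_def D_def)
  show ?thesis
    unfolding CNJ[of f]
  proof (rule SUP_least)
    fix p assume p: "p \<in> V \<times> V - {(0, 0)}"
    obtain x y where xy: "p = (x, y)" by fastforce
    have "ereal (N f x y / D f x y) \<le> ereal ((M / m) powr \<sigma>) * ereal (N g x y / D g x y)"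
      using quot[of x y] by simp
    also have "\<dots> \<le> ereal ((M / m) powr \<sigma>) * CNJ V \<sigma> g"
      unfolding CNJ[of g] using p xy by (intro ereal_mult_left_mono SUP_upper2[of p]) auto
    finally show "(case p of (x, y) \<Rightarrow> ereal (N f x y / D f x y))
                    \<le> ereal ((M / m) powr \<sigma>) * CNJ V \<sigma> g"
      by (simp add: xy)
  qed
qed

theorem theorem22:
  fixes X :: "'n::finite \<Rightarrow> 'a::real_vector set"
    and d :: "'n \<Rightarrow> 'a \<Rightarrow> 'a \<Rightarrow> real"
    and \<psi> \<phi> :: "real ^ 'n \<Rightarrow> real"
    and \<sigma> :: real
  assumes "CARD('n) \<ge> 2"
    and "\<And>i. subspace (X i)"
    and "\<And>i. X i \<noteq> {0}"
    and "\<And>i. Metric_space (X i) (d i)"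
    and "\<psi> \<in> Psi" and "\<phi> \<in> Psi"
    and "\<sigma> \<ge> 1"
  shows "ereal ((min_ratio \<psi> \<phi> / max_ratio \<psi> \<phi>) powr \<sigma>) * CNJ (prod_space X) \<sigma> (psi_metric d \<phi>)
           \<le> CNJ (prod_space X) \<sigma> (psi_metric d \<psi>)
       \<and> CNJ (prod_space X) \<sigma> (psi_metric d \<psi>)
           \<le> ereal ((max_ratio \<psi> \<phi> / min_ratio \<psi> \<phi>) powr \<sigma>) * CNJ (prod_space X) \<sigma> (psi_metric d \<phi>)"
proof -
  define m M where "m = min_ratio \<psi> \<phi>" and "M = max_ratio \<psi> \<phi>"
  let ?C = "\<lambda>\<psi>. CNJ (prod_space X) \<sigma> (psi_metric d \<psi>)"
  \<comment> \<open>Nonnegativity in \<open>Metric_space\<close> is stated for all points, not only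
    those of the carrier, so the comparison below holds for all vectors.\<close>
  have d: "0 \<le> d i a b" for i a b
    using assms(4) by (rule Metric_space.nonneg)
  have pos: "0 < m" "0 < M"
    unfolding m_def M_def using assms(5,6) by (rule min_ratio_pos max_ratio_pos)+
  have lower: "m * psi_metric d \<phi> x y \<le> psi_metric d \<psi> x y"
    and upper: "psi_metric d \<psi> x y \<le> M * psi_metric d \<phi> x y" for x y
    unfolding m_def M_def using d assms(5,6)
    by (rule min_ratio_psi_metric, rule max_ratio_psi_metric)
  have nonneg: "0 \<le> psi_metric d \<phi> x y" "0 \<le> psi_metric d \<psi> x y" for x y
    using psi_metric_nonneg[where d = d, OF d] assms(5,6) by blast+
  have "?C \<psi> \<le> ereal ((M / m) powr \<sigma>) * ?C \<phi>"
    using pos assms(7) nonneg lower upper by (intro CNJ_le_of_equivalent) auto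
  \<comment> \<open>Dividing the bounds by \<open>M\<close> and \<open>m\<close> places
    \<open>psi_metric d \<phi>\<close> between \<open>1 / M\<close> and \<open>1 / m\<close> times
    \<open>psi_metric d \<psi>\<close>.\<close>
  moreover have "?C \<phi> \<le> ereal (((1 / m) / (1 / M)) powr \<sigma>) * ?C \<psi>"
    using pos assms(7) nonneg lower upper
    by (intro CNJ_le_of_equivalent) (auto simp: field_simps)
  then have "ereal ((m / M) powr \<sigma>) * ?C \<phi>
               \<le> ereal ((m / M) powr \<sigma>) * (ereal ((M / m) powr \<sigma>) * ?C \<psi>)"
    by (intro ereal_mult_left_mono) simp_all
  \<comment> \<open>The two factors are finite, positive and mutually inverse, so by associativity
    they cancel even when \<open>c\<close> is infinite.\<close>
  moreover have "ereal ((m / M) powr \<sigma>) * (ereal ((M / m) powr \<sigma>) * c) = c" for c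
    using pos by (simp flip: mult.assoc powr_mult)
  ultimately show ?thesis
    by (simp add: m_def M_def)
qed

end
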